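(* Let $n\ge m$ be positive integers, $A\in\mathbb{R}^{n\times n}$, $B\in\mathbb{R}^{n\times m}$, $\Phi$ a real symmetric $n\times n$ matrix with $\Phi>0$, $\gamma>0$ real, and let $M$ be a real symmetric $n\times n$ matrix satisfying the standing assumptions on $M$ listed in the context. Let $\{\Lambda_k,k\in\mathbb{N}\}$ be the max-plus primal space fundamental solution semigroup defined in the context. Then, for any $k\in\mathbb{N}$ and any real symmetric $n\times n$ matrix $P_0$ such that $\Lambda_k^{22}+P_0<0$, the solution $P_k=\mathcal{R}_k(P_0)$ at horizon $k$ of the difference Riccati equation $P_{j+1}=\mathcal{R}(P_j)$ with initial condition $P_0$ is given by $$P_k=\Psi_k^p(P_0),$$ where $$\Psi_k^p(\Omega)=\Lambda_k^{11}-\Lambda_k^{12}(\Omega+\Lambda_k^{22})^{-1}\Lambda_k^{21}$$ for any real symmetric $n\times n$ matrix $\Omega$ satisfying $\Omega+\Lambda_k^{22}<0$.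
   Context: $\mathbb{N}=\{1,2,\dots\}$. $\mathbb{M}^{n\times n}$ denotes the real symmetric $n\times n$ matrices; $P>0$ ($P\ge0$) means positive (semi)definite, $P>Q$ means $P-Q>0$, and $P<0$ means $-P>0$. Riccati operator: $\mathcal{R}(P)=\Phi+A^TPA+A^TPB(\gamma^2I-B^TPB)^{-1}B^TPA$ for $P\in\mathbb{M}^{n\times n}$; $\mathcal{R}_0$ is the identity and $\mathcal{R}_{k+1}=\mathcal{R}\circ\mathcal{R}_k$. $P_k=\mathcal{R}_k(P_0)$ is a solution at step $k$ of the difference Riccati equation with initial condition $P_0$ if $\gamma^2I-B^T\mathcal{R}_i(P_0)B>0$ for $i=0,1,\dots,k-1$. Standing assumptions on $M\in\mathbb{M}^{n\times n}$: (i) $\gamma^2I-B^T\mathcal{R}_k(M)B>0$ for all integers $k\ge0$; (ii) $\mathcal{R}(M)-M>0$; (iii) $MB(\gamma^2I-B^TMB)^{-1}B^TM>0$. Dynamic programming evolution operators: $(\mathcal{S}\phi)(x)=\sup_{w\in\mathbb{R}^m}\{\frac12x^T\Phi x-\frac{\gamma^2}{2}|w|^2+\phi(Ax+Bw)\}$, $\mathcal{S}_0$ is the identity, and $\mathcal{S}_{k+1}\phi=\mathcal{S}(\mathcal{S}_k\phi)$. $\psi(x,z)=\frac12(x-z)^TM(x-z)$ for $x,z\in\mathbb{R}^n$, and $(\mathcal{D}_\psi\phi)(z)=-\sup_{x\in\mathbb{R}^n}\{\psi(x,z)-\phi(x)\}$. Auxiliary value function: $\widehat{\mathrm{S}}_k(x,z)=(\mathcal{S}_k\psi(\cdot,z))(x)$.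 Kernel: for $k\in\mathbb{N}$, $\mathrm{S}_k(x,y)=(\mathcal{D}_\psi\widehat{\mathrm{S}}_k(x,\cdot))(y)=-\sup_{z\in\mathbb{R}^n}\{\psi(z,y)-\widehat{\mathrm{S}}_k(x,z)\}$. Under the assumptions on $M$, $\mathrm{S}_k$ is a real-valued quadratic form $$\mathrm{S}_k(x,y)=\frac12\begin{bmatrix} x \\ y \end{bmatrix}^T\Lambda_k\begin{bmatrix} x \\ y \end{bmatrix},\qquad \Lambda_k=\begin{bmatrix}\Lambda_k^{11}&\Lambda_k^{12} \\ \Lambda_k^{21}&\Lambda_k^{22}\end{bmatrix}\in\mathbb{M}^{2n\times2n},$$ with $n\times n$ blocks; this defines $\Lambda_k$. The family $\{\Lambda_k,k\in\mathbb{N}\}$ is called the max-plus primal space fundamental solution semigroup. *)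

theory Defs
  imports "HOL-Analysis.Analysis"
begin

text \<open>
  Matrices are HOL-Analysis matrices: \<open>real ^ 'm ^ 'n\<close> has \<open>CARD('n)\<close> rows and
  \<open>CARD('m)\<close> columns, and \<open>mat c\<close> is \<open>c\<close> times the identity matrix.
\<close>

definition sym_mat :: "real ^ 'n ^ 'n \<Rightarrow> bool" where
  "sym_mat P \<longleftrightarrow> transpose P = P"

definition pos_def :: "real ^ 'n ^ 'n \<Rightarrow> bool" where
  "pos_def P \<longleftrightarrow> sym_mat P \<and> (\<forall>x. x \<noteq> 0 \<longrightarrow> x \<bullet> (P *v x) > 0)"

definition neg_def :: "real ^ 'n ^ 'n \<Rightarrow> bool" where
  "neg_def P \<longleftrightarrow> pos_def (- P)"


section \<open>Difference Riccati equation\<close>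

text \<open>The matrix \<open>\<gamma>\<^sup>2 I - B\<^sup>T P B\<close>.\<close>

definition riccati_gap :: "real ^ 'm ^ 'n \<Rightarrow> real \<Rightarrow> real ^ 'n ^ 'n \<Rightarrow> real ^ 'm ^ 'm" where
  "riccati_gap B \<gamma> P = mat (\<gamma>\<^sup>2) - transpose B ** P ** B"

definition riccati ::
  "real ^ 'n ^ 'n \<Rightarrow> real ^ 'n ^ 'n \<Rightarrow> real ^ 'm ^ 'n \<Rightarrow> real \<Rightarrow> real ^ 'n ^ 'n \<Rightarrow> real ^ 'n ^ 'n" where
  "riccati \<Phi> A B \<gamma> P =
     \<Phi> + transpose A ** P ** A
       + transpose A ** P ** B ** matrix_inv (riccati_gap B \<gamma> P) ** transpose B ** P ** A"

text \<open>
  \<open>P\<close> is the solution at step \<open>k\<close> with initial condition \<open>P0\<close>. The positivity requirement makes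
  every inverse occurring in the first \<open>k\<close> iterates a genuine one.
\<close>

definition dre_solution ::
  "real ^ 'n ^ 'n \<Rightarrow> real ^ 'n ^ 'n \<Rightarrow> real ^ 'm ^ 'n \<Rightarrow> real \<Rightarrow> real ^ 'n ^ 'n \<Rightarrow> nat
     \<Rightarrow> real ^ 'n ^ 'n \<Rightarrow> bool" where
  "dre_solution \<Phi> A B \<gamma> P0 k P \<longleftrightarrow>
     (\<forall>i<k. pos_def (riccati_gap B \<gamma> ((riccati \<Phi> A B \<gamma> ^^ i) P0))) \<and>
     P = (riccati \<Phi> A B \<gamma> ^^ k) P0"


section \<open>Dynamic programming and max-plus duality\<close>

text \<open>
  Suprema are taken in the extended reals. A real number is always one of the two
  operands of the sums and differences under a supremum, so \<open>\<infinity> - \<infinity>\<close> does not arise.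
\<close>

definition dp_op ::
  "real ^ 'n ^ 'n \<Rightarrow> real ^ 'n ^ 'n \<Rightarrow> real ^ 'm ^ 'n \<Rightarrow> real
     \<Rightarrow> (real ^ 'n \<Rightarrow> ereal) \<Rightarrow> real ^ 'n \<Rightarrow> ereal" where
  "dp_op \<Phi> A B \<gamma> \<phi> x =
     (SUP w. ereal (1 / 2 * (x \<bullet> (\<Phi> *v x)) - \<gamma>\<^sup>2 / 2 * (norm w)\<^sup>2) + \<phi> (A *v x + B *v w))"

definition psi :: "real ^ 'n ^ 'n \<Rightarrow> real ^ 'n \<Rightarrow> real ^ 'n \<Rightarrow> real" where
  "psi M x z = 1 / 2 * ((x - z) \<bullet> (M *v (x - z)))"

definition dual_op :: "real ^ 'n ^ 'n \<Rightarrow> (real ^ 'n \<Rightarrow> ereal) \<Rightarrow> real ^ 'n \<Rightarrow> ereal" where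
  "dual_op M \<phi> z = - (SUP x. ereal (psi M x z) - \<phi> x)"

definition aux_value ::
  "real ^ 'n ^ 'n \<Rightarrow> real ^ 'n ^ 'n \<Rightarrow> real ^ 'm ^ 'n \<Rightarrow> real \<Rightarrow> real ^ 'n ^ 'n \<Rightarrow> nat
     \<Rightarrow> real ^ 'n \<Rightarrow> real ^ 'n \<Rightarrow> ereal" where
  "aux_value \<Phi> A B \<gamma> M k x z = (dp_op \<Phi> A B \<gamma> ^^ k) (\<lambda>\<xi>. ereal (psi M \<xi> z)) x"

definition kernel ::
  "real ^ 'n ^ 'n \<Rightarrow> real ^ 'n ^ 'n \<Rightarrow> real ^ 'm ^ 'n \<Rightarrow> real \<Rightarrow> real ^ 'n ^ 'n \<Rightarrow> nat
     \<Rightarrow> real ^ 'n \<Rightarrow> real ^ 'n \<Rightarrow> ereal" where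
  "kernel \<Phi> A B \<gamma> M k x y = dual_op M (\<lambda>z. aux_value \<Phi> A B \<gamma> M k x z) y"


section \<open>The max-plus primal space fundamental solution semigroup\<close>

text \<open>
  \<open>2n \<times> 2n\<close> matrices are indexed by \<open>'n + 'n\<close>; \<open>Inl\<close> and \<open>Inr\<close> select the first and the
  second block of indices.
\<close>

definition stack :: "real ^ 'n \<Rightarrow> real ^ 'n \<Rightarrow> real ^ ('n + 'n)" where
  "stack x y = (\<chi> i. case i of Inl a \<Rightarrow> x $ a | Inr b \<Rightarrow> y $ b)"

definition block11 :: "real ^ ('n + 'n) ^ ('n + 'n) \<Rightarrow> real ^ 'n ^ 'n" where
  "block11 L = (\<chi> i j. L $ Inl i $ Inl j)"

definition block12 :: "real ^ ('n + 'n) ^ ('n + 'n) \<Rightarrow> real ^ 'n ^ 'n" where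
  "block12 L = (\<chi> i j. L $ Inl i $ Inr j)"

definition block21 :: "real ^ ('n + 'n) ^ ('n + 'n) \<Rightarrow> real ^ 'n ^ 'n" where
  "block21 L = (\<chi> i j. L $ Inr i $ Inl j)"

definition block22 :: "real ^ ('n + 'n) ^ ('n + 'n) \<Rightarrow> real ^ 'n ^ 'n" where
  "block22 L = (\<chi> i j. L $ Inr i $ Inr j)"

text \<open>
  The symmetric matrix of the kernel as a quadratic form. At most one symmetric matrix
  represents a given form; that one exists for \<open>k \<ge> 1\<close> is a consequence of the standing
  assumptions on \<open>M\<close>.
\<close>

definition Lam ::
  "real ^ 'n ^ 'n \<Rightarrow> real ^ 'n ^ 'n \<Rightarrow> real ^ 'm ^ 'n \<Rightarrow> real \<Rightarrow> real ^ 'n ^ 'n \<Rightarrow> nat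
     \<Rightarrow> real ^ ('n + 'n) ^ ('n + 'n)" where
  "Lam \<Phi> A B \<gamma> M k =
     (THE L. sym_mat L \<and>
        (\<forall>x y. kernel \<Phi> A B \<gamma> M k x y = ereal (1 / 2 * (stack x y \<bullet> (L *v stack x y)))))"

text \<open>Meaningful only where \<open>\<Omega> + block22 (Lam \<Phi> A B \<gamma> M k)\<close> is negative definite.\<close>

definition Psi_p ::
  "real ^ 'n ^ 'n \<Rightarrow> real ^ 'n ^ 'n \<Rightarrow> real ^ 'm ^ 'n \<Rightarrow> real \<Rightarrow> real ^ 'n ^ 'n \<Rightarrow> nat
     \<Rightarrow> real ^ 'n ^ 'n \<Rightarrow> real ^ 'n ^ 'n" where
  "Psi_p \<Phi> A B \<gamma> M k \<Omega> =
     (let L = Lam \<Phi> A B \<gamma> M k in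
      block11 L - block12 L ** matrix_inv (\<Omega> + block22 L) ** block21 L)"


section \<open>Standing assumptions on \<open>M\<close>\<close>

definition standing_assms ::
  "real ^ 'n ^ 'n \<Rightarrow> real ^ 'n ^ 'n \<Rightarrow> real ^ 'm ^ 'n \<Rightarrow> real \<Rightarrow> real ^ 'n ^ 'n \<Rightarrow> bool" where
  "standing_assms \<Phi> A B \<gamma> M \<longleftrightarrow>
     (\<forall>k. pos_def (riccati_gap B \<gamma> ((riccati \<Phi> A B \<gamma> ^^ k) M))) \<and>
     pos_def (riccati \<Phi> A B \<gamma> M - M) \<and>
     pos_def (M ** B ** matrix_inv (riccati_gap B \<gamma> M) ** transpose B ** M)"

end

theory Submission
  imports Defs
begin

text \<open>
  As \<open>B\<close> has at most as many columns as rows, the third standing assumption forces \<open>M\<close> and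
  \<open>B\<close> to be invertible. Write \<open>C\<close> for the inverse
  of \<open>B\<close> and \<open>G = \<gamma>\<^sup>2 C\<^sup>T C\<close>. Choosing the input \<open>w\<close> is then the same as choosing the
  successor state \<open>y = A x + B w\<close>, at the cost \<open>1/2 (y - A x)\<^sup>T G (y - A x)\<close>. Hence one step of
  dynamic programming is max-plus integration against a quadratic kernel
  (\<open>dp_op_eq_kernel\<close>), and \<open>k\<close> steps are integration against an iterated kernel
  \<open>1/2 x\<^sup>T X x + x\<^sup>T Y y + 1/2 y\<^sup>T Z y\<close>, provided that the intermediate suprema are finite.

  The main point, \<open>dp_op_funpow_eq_kernel\<close>, is an induction that produces this kernel together
  with the equivalence: \<open>Z + P < 0\<close> if and only if the first \<open>k\<close> Riccati gaps starting from
  \<open>P\<close> are positive. Both sides say that the total payoff plus \<open>1/2 y\<^sup>T P y\<close> is a strictly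
  concave function of the whole future trajectory. The induction step eliminates one of two
  variables from a quadratic form, and \<open>neg_def_schur_compl_swap\<close> says that the order of
  elimination does not matter: eliminating the intermediate state yields the new \<open>Z\<close>,
  eliminating the final state yields one Riccati step. The gaps starting from \<open>M\<close>
  are all positive, which makes the intermediate suprema finite.

  Max-plus duality recovers the iterated kernel from the auxiliary value function
  (\<open>dual_op_SUP_kform\<close>), because \<open>M\<close> is invertible and \<open>Z + M < 0\<close>. So the blocks of
  \<open>Lam\<close> are \<open>X\<close>, \<open>Y\<close>, \<open>Y\<^sup>T\<close> and \<open>Z\<close>. The hypothesis on \<open>P0\<close> now reads
  \<open>Z + P0 < 0\<close>, which gives the positive gaps. Finally the value function with terminal payoff
  \<open>1/2 y\<^sup>T P0 y\<close> is computed twice: step by step it is the form of the \<open>k\<close>-th Riccati iterate,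
  and by maximising kernel plus terminal payoff it is the form of the Schur complement
  \<open>X - Y (Z + P0)\<^sup>-\<^sup>1 Y\<^sup>T\<close>. Two symmetric matrices with the same quadratic form are equal.
\<close>

section \<open>Symmetric and definite matrices\<close>

lemma inner_matrix_vector:
  fixes A :: "real ^ 'm ^ 'n"
  shows "x \<bullet> (A *v y) = (transpose A *v x) \<bullet> y"
  by (simp add: dot_lmul_matrix)

lemma sym_mat_inner_commute:
  "sym_mat P \<Longrightarrow> x \<bullet> (P *v y) = y \<bullet> (P *v x)"
  by (metis inner_commute inner_matrix_vector sym_mat_def)

lemma transpose_add [simp]: "transpose (P + Q :: real ^ 'm ^ 'n) = transpose P + transpose Q"
  by (simp add: transpose_def vec_eq_iff)

lemma transpose_diff [simp]: "transpose (P - Q :: real ^ 'm ^ 'n) = transpose P - transpose Q"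
  by (simp add: transpose_def vec_eq_iff)

lemma transpose_uminus [simp]: "transpose (- P :: real ^ 'm ^ 'n) = - transpose P"
  by (simp add: transpose_def vec_eq_iff)

lemma transpose_scaleR [simp]: "transpose (c *\<^sub>R P :: real ^ 'm ^ 'n) = c *\<^sub>R transpose P"
  by (simp add: transpose_def vec_eq_iff)

lemma matrix_vector_uminus [simp]: "(- P :: real ^ 'm ^ 'n) *v x = - (P *v x)"
  by (simp add: matrix_vector_mult_def vec_eq_iff sum_negf)

lemma scaleR_matrix_vector: "(c *\<^sub>R P :: real ^ 'm ^ 'n) *v x = c *\<^sub>R (P *v x)"
  by (simp add: matrix_vector_mult_def vec_eq_iff sum_distrib_left mult.assoc)

lemma mat_matrix_vector: "(mat c :: real ^ 'n ^ 'n) *v x = c *\<^sub>R x"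
proof -
  have "(mat c :: real ^ 'n ^ 'n) = c *\<^sub>R mat 1"
    by (simp add: mat_def vec_eq_iff)
  then show ?thesis by (simp add: scaleR_matrix_vector)
qed

lemma matrix_eqI_bilinear:
  fixes P Q :: "real ^ 'm ^ 'n"
  assumes "\<And>x y. x \<bullet> (P *v y) = x \<bullet> (Q *v y)"
  shows "P = Q"
  by (metis assms matrix_eq vector_eq_rdot inner_commute)

lemma sym_mat_eqI:
  fixes P Q :: "real ^ 'n ^ 'n"
  assumes P: "sym_mat P" and Q: "sym_mat Q"
    and eq: "\<And>x. x \<bullet> (P *v x) = x \<bullet> (Q *v x)"
  shows "P = Q"
proof (rule matrix_eqI_bilinear)
  fix x y
  have "2 * (x \<bullet> (P *v y)) = 2 * (x \<bullet> (Q *v y))"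
    using eq[of "x + y"] eq[of x] eq[of y]
      sym_mat_inner_commute[OF P, of x y] sym_mat_inner_commute[OF Q, of x y]
    by (simp add: matrix_vector_right_distrib inner_add_left inner_add_right)
  then show "x \<bullet> (P *v y) = x \<bullet> (Q *v y)" by simp
qed

lemma neg_def_iff: "neg_def P \<longleftrightarrow> sym_mat P \<and> (\<forall>x. x \<noteq> 0 \<longrightarrow> x \<bullet> (P *v x) < 0)"
  by (simp add: neg_def_def pos_def_def sym_mat_def)

lemma neg_def_nonpos: "neg_def P \<Longrightarrow> x \<bullet> (P *v x) \<le> 0"
  by (cases "x = 0") (auto simp: neg_def_iff less_imp_le)

lemma injective_imp_invertible:
  fixes P :: "real ^ 'n ^ 'n"
  assumes "\<And>x. P *v x = 0 \<Longrightarrow> x = 0"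
  shows "invertible P"
  using assms by (simp add: invertible_left_inverse matrix_left_invertible_ker)

lemma invertible_neg_def: "neg_def P \<Longrightarrow> invertible P"
  by (rule injective_imp_invertible) (metis inner_zero_right neg_def_iff less_irrefl)

lemma invertible_pos_def: "pos_def P \<Longrightarrow> invertible P"
  by (rule injective_imp_invertible) (metis inner_zero_right pos_def_def less_irrefl)

lemma
  fixes P :: "real ^ 'n ^ 'n"
  assumes "invertible P"
  shows matrix_inv_right: "P ** matrix_inv P = mat 1"
    and matrix_inv_left: "matrix_inv P ** P = mat 1"
  using someI_ex[OF assms[unfolded invertible_def]] by (simp_all add: matrix_inv_def)

lemma matrix_inv_mult_vector:
  fixes P :: "real ^ 'n ^ 'n"
  assumes "invertible P"
  shows "P *v (matrix_inv P *v x) = x"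
  using assms by (simp add: matrix_vector_mul_assoc matrix_inv_right)

lemma sym_mat_matrix_inv:
  assumes "invertible P" "sym_mat P"
  shows "sym_mat (matrix_inv P)"
proof -
  have "transpose (matrix_inv P) ** P = mat 1"
    by (metis assms matrix_inv_right matrix_transpose_mul sym_mat_def transpose_mat)
  then show ?thesis
    unfolding sym_mat_def
    by (metis assms(1) matrix_inv_right matrix_mul_assoc matrix_mul_lid matrix_mul_rid)
qed


section \<open>Maximising concave quadratic functions\<close>

lemma SUP_ereal_eq_max:
  assumes "\<And>v. f v \<le> f v0"
  shows "(SUP v. ereal (f v)) = ereal (f v0)"
  by (rule antisym) (auto intro: SUP_least SUP_upper simp: assms)

text \<open>
  Completing the square: the function differs from its value at the stationary point by the
  quadratic form of \<open>N\<close> in the displacement.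
\<close>

lemma concave_quadratic_le_stationary:
  assumes N: "neg_def N" and stat: "N *v y0 + b = 0"
  shows "c + y \<bullet> b + (y \<bullet> (N *v y)) / 2 \<le> c + y0 \<bullet> b + (y0 \<bullet> (N *v y0)) / 2"
proof -
  have b: "b = - (N *v y0)" using stat by (simp add: eq_neg_iff_add_eq_0 add.commute)
  have "y0 \<bullet> (N *v y) = y \<bullet> (N *v y0)"
    using N by (simp add: neg_def_iff sym_mat_inner_commute)
  then show ?thesis
    using neg_def_nonpos[OF N, of "y - y0"]
    by (simp add: b matrix_vector_mult_diff_distrib inner_diff_left inner_diff_right)
qed

lemma SUP_concave_quadratic:
  assumes N: "neg_def N"
  shows "(SUP y. ereal (c + y \<bullet> b + (y \<bullet> (N *v y)) / 2))
           = ereal (c - (b \<bullet> (matrix_inv N *v b)) / 2)"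
proof -
  define y0 where "y0 = - (matrix_inv N *v b)"
  have Ny0: "N *v y0 = - b"
    using matrix_inv_mult_vector[OF invertible_neg_def[OF N], of b]
      vec.neg[of N "matrix_inv N *v b"] by (simp add: y0_def)
  have "(SUP y. ereal (c + y \<bullet> b + (y \<bullet> (N *v y)) / 2))
          = ereal (c + y0 \<bullet> b + (y0 \<bullet> (N *v y0)) / 2)"
    by (rule SUP_ereal_eq_max, rule concave_quadratic_le_stationary[OF N]) (simp add: Ny0)
  then show ?thesis
    by (simp add: Ny0) (simp add: y0_def inner_commute)
qed


section \<open>Quadratic kernels and Schur complements\<close>

definition kform ::
  "real ^ 'n ^ 'n \<Rightarrow> real ^ 'n ^ 'n \<Rightarrow> real ^ 'n ^ 'n \<Rightarrow> real ^ 'n \<Rightarrow> real ^ 'n \<Rightarrow> real" where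
  "kform X Y Z x y = (x \<bullet> (X *v x)) / 2 + x \<bullet> (Y *v y) + (y \<bullet> (Z *v y)) / 2"

definition schur_compl :: "real ^ 'n ^ 'n \<Rightarrow> real ^ 'n ^ 'n \<Rightarrow> real ^ 'n ^ 'n \<Rightarrow> real ^ 'n ^ 'n" where
  "schur_compl X Y Z = X - Y ** matrix_inv Z ** transpose Y"

lemma sym_mat_schur_compl:
  assumes "sym_mat X" "neg_def Z"
  shows "sym_mat (schur_compl X Y Z)"
  using assms sym_mat_matrix_inv[OF invertible_neg_def[OF assms(2)]]
  by (simp add: schur_compl_def sym_mat_def neg_def_iff matrix_transpose_mul matrix_mul_assoc)

lemma schur_compl_form:
  "x \<bullet> (schur_compl X Y Z *v y)
     = x \<bullet> (X *v y) - (transpose Y *v x) \<bullet> (matrix_inv Z *v (transpose Y *v y))"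
  by (simp add: schur_compl_def matrix_vector_mult_diff_rdistrib inner_diff_right
      inner_matrix_vector[of x Y] flip: matrix_vector_mul_assoc)

text \<open>Eliminating the second variable of a kernel leaves the Schur complement of that block.\<close>

lemma SUP_kform_add_quadratic:
  assumes "neg_def (Z + P)"
  shows "(SUP y. ereal (kform X Y Z x y) + ereal ((y \<bullet> (P *v y)) / 2))
           = ereal ((x \<bullet> (schur_compl X Y (Z + P) *v x)) / 2)"
proof -
  have "ereal (kform X Y Z x y) + ereal ((y \<bullet> (P *v y)) / 2)
          = ereal ((x \<bullet> (X *v x)) / 2 + y \<bullet> (transpose Y *v x) + (y \<bullet> ((Z + P) *v y)) / 2)" for y
    by (simp add: kform_def inner_matrix_vector[of x Y] inner_commute
        matrix_vector_mult_add_rdistrib inner_add_right add_divide_distrib)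
  then show ?thesis
    by (simp add: SUP_concave_quadratic[OF assms] schur_compl_form diff_divide_distrib)
qed

text \<open>
  The Schur complement is negative definite exactly when the joint form is, since its form at
  \<open>y\<close> is twice the maximum of the joint form over \<open>v\<close>.
\<close>

lemma neg_def_schur_compl_iff:
  fixes N C D :: "real ^ 'n ^ 'n"
  assumes N: "neg_def N" and D: "sym_mat D"
  shows "neg_def (schur_compl D C N) \<longleftrightarrow>
    (\<forall>v y. (v, y) \<noteq> (0, 0) \<longrightarrow> kform D C N y v < 0)"
proof -
  let ?v0 = "\<lambda>y. - (matrix_inv N *v (transpose C *v y))"
  have kf: "kform D C N y v
     = (y \<bullet> (D *v y)) / 2 + v \<bullet> (transpose C *v y) + (v \<bullet> (N *v v)) / 2" for y v
    by (simp add: kform_def inner_matrix_vector[of y C] inner_commute)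
  have Nv0: "N *v ?v0 y = - (transpose C *v y)" for y
    using matrix_inv_mult_vector[OF invertible_neg_def[OF N], of "transpose C *v y"]
      vec.neg[of N "matrix_inv N *v (transpose C *v y)"] by simp
  have at: "kform D C N y (?v0 y) = (y \<bullet> (schur_compl D C N *v y)) / 2" for y
    unfolding kf Nv0 by (simp add: schur_compl_form inner_commute diff_divide_distrib)
  have le: "kform D C N y v \<le> (y \<bullet> (schur_compl D C N *v y)) / 2" for y v
    unfolding at[symmetric] kf
    by (rule concave_quadratic_le_stationary[OF N]) (simp only: Nv0 left_minus)
  show ?thesis
  proof (intro iffI allI impI)
    fix v y :: "real ^ 'n" assume S: "neg_def (schur_compl D C N)" and nz: "(v, y) \<noteq> (0, 0)"
    show "kform D C N y v < 0"
    proof (cases "y = 0")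
      case True
      then show ?thesis using N nz by (simp add: kform_def neg_def_iff)
    next
      case False
      then show ?thesis using le[of y v] S by (force simp: neg_def_iff)
    qed
  next
    assume neg: "\<forall>v y. (v, y) \<noteq> (0, 0) \<longrightarrow> kform D C N y v < 0"
    have "y \<bullet> (schur_compl D C N *v y) < 0" if "y \<noteq> 0" for y
      using neg[rule_format, of "?v0 y" y] that unfolding at by simp
    then show "neg_def (schur_compl D C N)"
      using sym_mat_schur_compl[OF D N] by (simp add: neg_def_iff)
  qed
qed

text \<open>
  Both sides characterise negative definiteness of the same joint form, once with \<open>v\<close> and once
  with \<open>y\<close> eliminated. Definiteness of \<open>D\<close> follows from the left-hand side by restricting the
  joint form to \<open>v = 0\<close>.
\<close>

lemma neg_def_schur_compl_swap:
  fixes N C D :: "real ^ 'n ^ 'n"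
  assumes N: "neg_def N" and D: "sym_mat D"
  shows "neg_def (schur_compl D C N) \<longleftrightarrow> neg_def D \<and> neg_def (schur_compl N (transpose C) D)"
proof -
  have swap: "kform N (transpose C) D v y = kform D C N y v" for v y
    by (simp add: kform_def inner_matrix_vector[of y C] inner_commute)
  have "neg_def D" if neg: "\<forall>v y. (v, y) \<noteq> (0, 0) \<longrightarrow> kform D C N y v < 0"
    unfolding neg_def_iff
  proof (intro conjI allI impI D)
    fix y :: "real ^ 'n" assume "y \<noteq> 0"
    then show "y \<bullet> (D *v y) < 0" using neg[rule_format, of 0 y] by (simp add: kform_def)
  qed
  then show ?thesis
    using neg_def_schur_compl_iff[OF N D, of C]
      neg_def_schur_compl_iff[of D N "transpose C"] N
    unfolding swap neg_def_iff by auto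
qed

text \<open>The max-plus product of two quadratic kernels.\<close>

lemma SUP_kform_compose:
  assumes N: "neg_def (Z + X1)"
  shows "(SUP v. ereal (kform X Y Z x v + kform X1 Y1 Z1 v y))
    = ereal (kform (schur_compl X Y (Z + X1)) (- (Y ** matrix_inv (Z + X1) ** Y1))
               (schur_compl Z1 (transpose Y1) (Z + X1)) x y)"
proof -
  let ?N = "matrix_inv (Z + X1)"
  have sN: "sym_mat ?N"
    using N by (simp add: sym_mat_matrix_inv invertible_neg_def neg_def_iff)
  have eq: "kform X Y Z x v + kform X1 Y1 Z1 v y
     = ((x \<bullet> (X *v x)) / 2 + (y \<bullet> (Z1 *v y)) / 2)
        + v \<bullet> (transpose Y *v x + Y1 *v y) + (v \<bullet> ((Z + X1) *v v)) / 2" for v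
    by (simp add: kform_def inner_matrix_vector[of x Y] inner_commute inner_add_right
        matrix_vector_mult_add_rdistrib add_divide_distrib)
  have "(Y1 *v y) \<bullet> (?N *v (transpose Y *v x)) = (transpose Y *v x) \<bullet> (?N *v (Y1 *v y))"
    by (rule sym_mat_inner_commute[OF sN])
  moreover have "x \<bullet> (Y ** ?N ** Y1 *v y) = (transpose Y *v x) \<bullet> (?N *v (Y1 *v y))"
    by (simp add: inner_matrix_vector[of x Y] flip: matrix_vector_mul_assoc)
  ultimately show ?thesis
    unfolding eq SUP_concave_quadratic[OF N]
    by (simp add: kform_def schur_compl_form inner_add_left inner_add_right
        matrix_vector_right_distrib diff_divide_distrib add_divide_distrib)
qed

text \<open>
  Max-plus integration is associative. The final payoff \<open>\<phi>\<close> is arbitrary; points where it is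
  \<open>- \<infinity>\<close> need a separate argument because adding \<open>- \<infinity>\<close> does not commute with suprema in
  general. Finiteness of the composed kernel \<open>m\<close> rescues these points.
\<close>

lemma SUP_SUP_compose:
  fixes p :: "'a \<Rightarrow> real" and l :: "'a \<Rightarrow> 'b \<Rightarrow> real" and \<phi> :: "'b \<Rightarrow> ereal"
  assumes sup: "\<And>y. (SUP v. ereal (p v + l v y)) = ereal (m y)"
  shows "(SUP v. ereal (p v) + (SUP y. ereal (l v y) + \<phi> y)) = (SUP y. ereal (m y) + \<phi> y)"
proof -
  have "(SUP v. ereal (p v) + (SUP y. ereal (l v y) + \<phi> y))
      = (SUP v. SUP y. ereal (p v + l v y) + \<phi> y)"
    by (subst SUP_ereal_add_right[symmetric])
      (auto simp flip: plus_ereal.simps(1) simp: add.assoc)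
  also have "\<dots> = (SUP y. SUP v. ereal (p v + l v y) + \<phi> y)"
    by (rule SUP_commute)
  also have "\<dots> = (SUP y. ereal (m y) + \<phi> y)"
  proof (rule SUP_cong[OF refl])
    fix y
    show "(SUP v. ereal (p v + l v y) + \<phi> y) = ereal (m y) + \<phi> y"
    proof (cases "\<phi> y = - \<infinity>")
      case True
      then show ?thesis by simp
    next
      case False
      then show ?thesis by (simp add: SUP_ereal_add_left sup)
    qed
  qed
  finally show ?thesis .
qed


section \<open>Dynamic programming with an invertible input matrix\<close>

lemma sym_mat_riccati:
  assumes "sym_mat \<Phi>" "sym_mat P" "pos_def (riccati_gap B \<gamma> P)"
  shows "sym_mat (riccati \<Phi> A B \<gamma> P)"
  using assms(1,2) sym_mat_matrix_inv[OF invertible_pos_def[OF assms(3)]] assms(3)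
  by (simp add: riccati_def sym_mat_def pos_def_def matrix_transpose_mul matrix_mul_assoc)

lemma riccati_gap_form:
  "w \<bullet> (riccati_gap B \<gamma> P *v w) = \<gamma>\<^sup>2 * (norm w)\<^sup>2 - (B *v w) \<bullet> (P *v (B *v w))"
  by (simp add: riccati_gap_def matrix_vector_mult_diff_rdistrib inner_diff_right mat_matrix_vector
      dot_square_norm inner_matrix_vector[of w "transpose B"] del: transpose_matrix_vector
      flip: matrix_vector_mul_assoc)

text \<open>
  The Riccati operator is dynamic programming on quadratic payoffs: a positive gap makes the
  maximand strictly concave in \<open>w\<close>, and completing the square gives the value.
\<close>

lemma dp_op_quadratic:
  fixes B :: "real ^ 'm ^ 'n"
  assumes P: "sym_mat P" and gap: "pos_def (riccati_gap B \<gamma> P)"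
  shows "dp_op \<Phi> A B \<gamma> (\<lambda>y. ereal ((y \<bullet> (P *v y)) / 2)) x
           = ereal ((x \<bullet> (riccati \<Phi> A B \<gamma> P *v x)) / 2)"
proof -
  let ?N = "- riccati_gap B \<gamma> P"
  let ?b = "transpose B *v (P *v (A *v x))"
  let ?c = "(x \<bullet> (\<Phi> *v x)) / 2 + ((A *v x) \<bullet> (P *v (A *v x))) / 2"
  have N: "neg_def ?N" using gap by (simp add: neg_def_def)
  have eq: "ereal (1 / 2 * (x \<bullet> (\<Phi> *v x)) - \<gamma>\<^sup>2 / 2 * (norm w)\<^sup>2)
       + ereal (((A *v x + B *v w) \<bullet> (P *v (A *v x + B *v w))) / 2)
     = ereal (?c + w \<bullet> ?b + (w \<bullet> (?N *v w)) / 2)" for w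
  proof -
    have "(A *v x) \<bullet> (P *v (B *v w)) = (B *v w) \<bullet> (P *v (A *v x))"
      by (rule sym_mat_inner_commute[OF P])
    moreover have "w \<bullet> ?b = (B *v w) \<bullet> (P *v (A *v x))"
      by (simp add: inner_matrix_vector[of w "transpose B"] del: transpose_matrix_vector)
    ultimately show ?thesis
      by (simp add: riccati_gap_form matrix_vector_right_distrib inner_add_left inner_add_right
          field_simps)
  qed
  have inv: "matrix_inv ?N *v v = - (matrix_inv (riccati_gap B \<gamma> P) *v v)" for v
  proof -
    have "?N *v (matrix_inv ?N *v v) = ?N *v (- (matrix_inv (riccati_gap B \<gamma> P) *v v))"
      using matrix_inv_mult_vector[OF invertible_neg_def[OF N], of v]
        matrix_inv_mult_vector[OF invertible_pos_def[OF gap], of v]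
        vec.neg[of "riccati_gap B \<gamma> P" "matrix_inv (riccati_gap B \<gamma> P) *v v"] by simp
    then show ?thesis
      by (metis invertible_neg_def[OF N] matrix_inv_left matrix_vector_mul_assoc
          matrix_vector_mul_lid)
  qed
  have "transpose (transpose A ** P ** B) *v x = ?b"
    using P by (simp add: matrix_transpose_mul sym_mat_def del: transpose_matrix_vector
      flip: matrix_vector_mul_assoc)
  then have "x \<bullet> (riccati \<Phi> A B \<gamma> P *v x)
      = x \<bullet> (\<Phi> *v x) + (A *v x) \<bullet> (P *v (A *v x)) + ?b \<bullet> (matrix_inv (riccati_gap B \<gamma> P) *v ?b)"
    using inner_matrix_vector[of x "transpose A ** P ** B"
        "matrix_inv (riccati_gap B \<gamma> P) *v ?b"]
      inner_matrix_vector[of x "transpose A" "P *v (A *v x)"]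
    by (simp add: riccati_def matrix_vector_mult_add_rdistrib inner_add_right
      del: transpose_matrix_vector flip: matrix_vector_mul_assoc)
  then show ?thesis
    unfolding dp_op_def eq SUP_concave_quadratic[OF N] inv
    by (simp add: add_divide_distrib)
qed

lemma dp_op_funpow_quadratic:
  assumes "sym_mat \<Phi>" "sym_mat P"
    and "\<forall>i<k. pos_def (riccati_gap B \<gamma> ((riccati \<Phi> A B \<gamma> ^^ i) P))"
  shows "sym_mat ((riccati \<Phi> A B \<gamma> ^^ k) P) \<and>
    (dp_op \<Phi> A B \<gamma> ^^ k) (\<lambda>y. ereal ((y \<bullet> (P *v y)) / 2))
      = (\<lambda>x. ereal ((x \<bullet> ((riccati \<Phi> A B \<gamma> ^^ k) P *v x)) / 2))"
  using assms(3)
proof (induction k)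
  case 0
  then show ?case using assms by simp
next
  case (Suc k)
  then have "pos_def (riccati_gap B \<gamma> ((riccati \<Phi> A B \<gamma> ^^ k) P))" by simp
  with Suc assms show ?case
    by (auto simp: sym_mat_riccati dp_op_quadratic)
qed

locale invertible_input =
  fixes \<Phi> A :: "real ^ 'n ^ 'n" and B :: "real ^ 'm ^ 'n" and C :: "real ^ 'n ^ 'm" and \<gamma> :: real
  assumes sym_\<Phi>: "sym_mat \<Phi>" and BC: "B ** C = mat 1" and CB: "C ** B = mat 1"
begin

definition G :: "real ^ 'n ^ 'n" where
  "G = \<gamma>\<^sup>2 *\<^sub>R (transpose C ** C)"

text \<open>Together with \<open>- G\<close>, the blocks of the one-step kernel.\<close>

abbreviation X1 where "X1 \<equiv> \<Phi> - transpose A ** G ** A"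
abbreviation Y1 where "Y1 \<equiv> transpose A ** G"

abbreviation "\<R> \<equiv> riccati \<Phi> A B \<gamma>"

lemma G_form: "u \<bullet> (G *v u) = \<gamma>\<^sup>2 * (norm (C *v u))\<^sup>2"
  by (simp add: G_def scaleR_matrix_vector dot_square_norm inner_matrix_vector[of u "transpose C"]
      del: transpose_matrix_vector flip: matrix_vector_mul_assoc)

lemma sym_G: "sym_mat G"
  by (simp add: G_def sym_mat_def matrix_transpose_mul)

lemma C_B [simp]: "C *v (B *v w) = w"
  by (simp add: matrix_vector_mul_assoc CB)

lemma B_C [simp]: "B *v (C *v u) = u"
  by (simp add: matrix_vector_mul_assoc BC)

lemma sym_X1: "sym_mat X1"
  using sym_\<Phi> sym_G by (simp add: sym_mat_def matrix_transpose_mul matrix_mul_assoc)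

text \<open>The gap is \<open>B\<^sup>T (G - P) B\<close>, a congruence of \<open>G - P\<close>.\<close>

lemma pos_def_riccati_gap_iff:
  assumes P: "sym_mat P"
  shows "pos_def (riccati_gap B \<gamma> P) \<longleftrightarrow> neg_def (- G + P)"
proof -
  have eq: "- G + P = P - G" by simp
  have form: "y \<bullet> ((P - G) *v y) = - ((C *v y) \<bullet> (riccati_gap B \<gamma> P *v (C *v y)))" for y
    by (simp add: riccati_gap_form matrix_vector_mult_diff_rdistrib inner_diff_right G_form)
  have sym: "sym_mat (P - G)" "sym_mat (riccati_gap B \<gamma> P)"
    using P sym_G
    by (simp_all add: riccati_gap_def sym_mat_def matrix_transpose_mul matrix_mul_assoc transpose_mat)
  have "C *v y = 0 \<longleftrightarrow> y = 0" for y
    by (metis B_C matrix_vector_mult_0_right)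
  then have "(\<forall>w. w \<noteq> 0 \<longrightarrow> w \<bullet> (riccati_gap B \<gamma> P *v w) > 0)
      \<longleftrightarrow> (\<forall>y. y \<noteq> 0 \<longrightarrow> (C *v y) \<bullet> (riccati_gap B \<gamma> P *v (C *v y)) > 0)"
    by (metis C_B)
  then show ?thesis
    unfolding eq by (simp add: pos_def_def neg_def_iff sym form)
qed

text \<open>The substitution \<open>y = A x + B w\<close>, a bijection between inputs and successor states.\<close>

lemma dp_op_eq_kernel:
  "dp_op \<Phi> A B \<gamma> \<phi> x = (SUP y. ereal (kform X1 Y1 (- G) x y) + \<phi> y)"
proof -
  have eq: "1 / 2 * (x \<bullet> (\<Phi> *v x)) - \<gamma>\<^sup>2 / 2 * (norm w)\<^sup>2 = kform X1 Y1 (- G) x (A *v x + B *v w)"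
    for w
  proof -
    have "\<gamma>\<^sup>2 * (norm w)\<^sup>2 = (B *v w) \<bullet> (G *v (B *v w))"
      by (simp add: G_form)
    moreover have "(B *v w) \<bullet> (G *v (A *v x)) = (A *v x) \<bullet> (G *v (B *v w))"
      by (rule sym_mat_inner_commute[OF sym_G])
    moreover have "x \<bullet> (transpose A ** G *v v) = (A *v x) \<bullet> (G *v v)" for v
      by (simp add: inner_matrix_vector[of x "transpose A"] del: transpose_matrix_vector
          flip: matrix_vector_mul_assoc)
    moreover have "x \<bullet> (transpose A ** G ** A *v v) = (A *v x) \<bullet> (G *v (A *v v))" for v
      by (simp add: inner_matrix_vector[of x "transpose A"] del: transpose_matrix_vector
          flip: matrix_vector_mul_assoc)
    ultimately show ?thesis
      by (simp add: kform_def matrix_vector_mult_diff_rdistrib matrix_vector_right_distrib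
          inner_add_left inner_add_right inner_diff_right field_simps)
  qed
  have "surj (\<lambda>w. A *v x + B *v w)"
    by (rule surjI[where f = "\<lambda>y. C *v (y - A *v x)"]) simp
  then have "(SUP y. ereal (kform X1 Y1 (- G) x y) + \<phi> y)
     = (SUP y \<in> range (\<lambda>w. A *v x + B *v w). ereal (kform X1 Y1 (- G) x y) + \<phi> y)"
    by simp
  then show ?thesis
    unfolding dp_op_def eq by (simp add: image_image)
qed

text \<open>
  Instead of a matrix calculation, two evaluations of the same supremum, once over inputs and
  once over successor states.
\<close>

lemma riccati_eq_schur_compl:
  assumes P: "sym_mat P" and gap: "pos_def (riccati_gap B \<gamma> P)"
  shows "\<R> P = schur_compl X1 Y1 (- G + P)"
proof (rule sym_mat_eqI)
  have neg: "neg_def (- G + P)" using pos_def_riccati_gap_iff[OF P] gap by simp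
  show "sym_mat (\<R> P)" by (rule sym_mat_riccati[OF sym_\<Phi> P gap])
  show "sym_mat (schur_compl X1 Y1 (- G + P))" by (rule sym_mat_schur_compl[OF sym_X1 neg])
  show "x \<bullet> (\<R> P *v x) = x \<bullet> (schur_compl X1 Y1 (- G + P) *v x)" for x
    using dp_op_quadratic[OF P gap, of \<Phi> A x] SUP_kform_add_quadratic[OF neg, of X1 Y1 x]
    by (simp add: dp_op_eq_kernel)
qed

text \<open>
  The composition of a kernel with the one-step kernel is finite because \<open>X1\<close> lies below
  \<open>\<R> M\<close>: moving to the state \<open>0\<close> is one of the choices whose supremum has the form of
  \<open>\<R> M\<close>.
\<close>

lemma neg_def_add_X1:
  assumes M: "sym_mat M" and gap: "pos_def (riccati_gap B \<gamma> M)"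
    and Z: "sym_mat Z" and neg: "neg_def (Z + \<R> M)"
  shows "neg_def (Z + X1)"
proof -
  have "x \<bullet> (X1 *v x) \<le> x \<bullet> (\<R> M *v x)" for x
  proof -
    have "ereal (kform X1 Y1 (- G) x 0) + ereal ((0 \<bullet> (M *v 0)) / 2)
        \<le> (SUP y. ereal (kform X1 Y1 (- G) x y) + ereal ((y \<bullet> (M *v y)) / 2))"
      by (rule SUP_upper) simp
    then show ?thesis
      using dp_op_quadratic[OF M gap, of \<Phi> A x] by (simp add: dp_op_eq_kernel kform_def)
  qed
  then have "x \<bullet> ((Z + X1) *v x) \<le> x \<bullet> ((Z + \<R> M) *v x)" for x
    by (simp add: matrix_vector_mult_add_rdistrib inner_add_right)
  moreover have "sym_mat (Z + X1)" using Z sym_X1 by (simp add: sym_mat_def)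
  ultimately show ?thesis
    using neg unfolding neg_def_iff by (meson le_less_trans)
qed

text \<open>
  In the induction step a new stage is added in front of the terminal payoff. That keeps the
  payoff \<open>\<phi>\<close> general in the kernel representation, and turns the gaps of \<open>P\<close> into the gap of
  \<open>P\<close> itself followed by those of \<open>\<R> P\<close>, to which the induction hypothesis applies.
  The matrix \<open>M\<close> only serves, through \<open>Z + \<R> M < 0\<close>, to make every composition finite.
\<close>

lemma dp_op_funpow_eq_kernel:
  assumes M: "sym_mat M" and gapM: "\<And>i. pos_def (riccati_gap B \<gamma> ((\<R> ^^ i) M))"
  shows "\<exists>X Y Z. sym_mat X \<and> sym_mat Z \<and>
    (\<forall>\<phi> x. (dp_op \<Phi> A B \<gamma> ^^ Suc k) \<phi> x = (SUP y. ereal (kform X Y Z x y) + \<phi> y)) \<and>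
    (\<forall>P. sym_mat P \<longrightarrow>
       (neg_def (Z + P) \<longleftrightarrow> (\<forall>i<Suc k. pos_def (riccati_gap B \<gamma> ((\<R> ^^ i) P)))))"
proof (induction k)
  case 0
  have "sym_mat (- G)" using sym_G by (simp add: sym_mat_def)
  then show ?case
    using sym_X1 pos_def_riccati_gap_iff
    by (intro exI[of _ X1] exI[of _ Y1] exI[of _ "- G"]) (auto simp: dp_op_eq_kernel)
next
  case (Suc k)
  then obtain X Y Z where X: "sym_mat X" and Z: "sym_mat Z"
    and dp: "\<And>\<phi> x. (dp_op \<Phi> A B \<gamma> ^^ Suc k) \<phi> x = (SUP y. ereal (kform X Y Z x y) + \<phi> y)"
    and gaps: "\<And>P. sym_mat P \<Longrightarrow>
      neg_def (Z + P) \<longleftrightarrow> (\<forall>i<Suc k. pos_def (riccati_gap B \<gamma> ((\<R> ^^ i) P)))"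
    by blast
  have gap0: "pos_def (riccati_gap B \<gamma> M)" using gapM[of 0] by simp
  have "pos_def (riccati_gap B \<gamma> ((\<R> ^^ i) (\<R> M)))" for i
    using gapM[of "Suc i"] by (simp add: funpow_swap1)
  then have "neg_def (Z + \<R> M)"
    using gaps[OF sym_mat_riccati[OF sym_\<Phi> M gap0]] by simp
  then have N: "neg_def (Z + X1)" by (rule neg_def_add_X1[OF M gap0 Z])
  let ?X = "schur_compl X Y (Z + X1)"
  let ?Y = "- (Y ** matrix_inv (Z + X1) ** Y1)"
  let ?Z = "schur_compl (- G) (transpose Y1) (Z + X1)"
  have sG: "sym_mat (- G)" using sym_G by (simp add: sym_mat_def)
  have "(dp_op \<Phi> A B \<gamma> ^^ Suc (Suc k)) \<phi> x = (SUP y. ereal (kform ?X ?Y ?Z x y) + \<phi> y)" for \<phi> x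
  proof -
    have "(dp_op \<Phi> A B \<gamma> ^^ Suc (Suc k)) \<phi> x = (dp_op \<Phi> A B \<gamma> ^^ Suc k) (dp_op \<Phi> A B \<gamma> \<phi>) x"
      by (simp add: funpow_swap1)
    also have "\<dots> = (SUP v. ereal (kform X Y Z x v)
                       + (SUP y. ereal (kform X1 Y1 (- G) v y) + \<phi> y))"
      by (simp only: dp dp_op_eq_kernel)
    also have "\<dots> = (SUP y. ereal (kform ?X ?Y ?Z x y) + \<phi> y)"
      by (rule SUP_SUP_compose) (rule SUP_kform_compose[OF N])
    finally show ?thesis .
  qed
  moreover have "neg_def (?Z + P) \<longleftrightarrow>
      (\<forall>i<Suc (Suc k). pos_def (riccati_gap B \<gamma> ((\<R> ^^ i) P)))" if P: "sym_mat P" for P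
  proof -
    have "neg_def (?Z + P) \<longleftrightarrow> neg_def (schur_compl (- G + P) (transpose Y1) (Z + X1))"
      by (simp add: schur_compl_def algebra_simps)
    also have "\<dots> \<longleftrightarrow> neg_def (- G + P) \<and> neg_def (schur_compl (Z + X1) Y1 (- G + P))"
      using neg_def_schur_compl_swap[OF N, of "- G + P" "transpose Y1"] P sG
      by (simp add: sym_mat_def)
    also have "\<dots> \<longleftrightarrow> pos_def (riccati_gap B \<gamma> P) \<and> neg_def (Z + \<R> P)"
      using riccati_eq_schur_compl[OF P] pos_def_riccati_gap_iff[OF P]
      by (auto simp: schur_compl_def add_diff_eq)
    also have "\<dots> \<longleftrightarrow> pos_def (riccati_gap B \<gamma> P) \<and>
        (\<forall>i<Suc k. pos_def (riccati_gap B \<gamma> ((\<R> ^^ Suc i) P)))"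
      using gaps[OF sym_mat_riccati[OF sym_\<Phi> P]] by (auto simp: funpow_swap1)
    also have "\<dots> \<longleftrightarrow> (\<forall>i<Suc (Suc k). pos_def (riccati_gap B \<gamma> ((\<R> ^^ i) P)))"
      unfolding All_less_Suc2[of "Suc k"] by simp
    finally show ?thesis .
  qed
  ultimately show ?case
    using sym_mat_schur_compl[OF X N] sym_mat_schur_compl[OF sG N] by blast
qed

end


section \<open>The kernel and its matrix\<close>

text \<open>
  A biconjugation argument. Taking \<open>v = y\<close> in the inner supremum gives one inequality, because
  the two occurrences of \<open>psi\<close> cancel. For the converse, invertibility of \<open>M\<close> supplies a \<open>z\<close>
  for which \<open>y\<close> is the stationary point, hence the maximiser, of the inner problem.
\<close>

lemma dual_op_SUP_kform:
  assumes M: "sym_mat M" and inv: "invertible M" and neg: "neg_def (Z + M)"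
  shows "dual_op M (\<lambda>z. SUP v. ereal (kform X Y Z x v) + ereal (psi M v z)) y
           = ereal (kform X Y Z x y)"
proof -
  define F where "F z = (SUP v. ereal (kform X Y Z x v) + ereal (psi M v z))" for z
  have psi_commute: "psi M z y = psi M y z" for z
    using vec.neg[of M "y - z"] inner_minus_left[of "y - z"] by (simp add: psi_def)
  have "ereal (psi M z y) - F z \<le> ereal (- kform X Y Z x y)" for z
  proof -
    have "ereal (kform X Y Z x y + psi M y z) \<le> F z"
      unfolding F_def by (rule SUP_upper2[of y]) auto
    then show ?thesis
      by (cases "F z") (auto simp: psi_commute)
  qed
  moreover obtain z where "ereal (psi M z y) - F z = ereal (- kform X Y Z x y)"
  proof
    \<comment> \<open>solves \<open>Y\<^sup>T x + Z y + M (y - z) = 0\<close>, the vanishing of the gradient at \<open>v = y\<close>\<close>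
    define z where "z = matrix_inv M *v (transpose Y *v x + (Z + M) *v y)"
    have Mz: "M *v z = transpose Y *v x + (Z + M) *v y"
      unfolding z_def by (rule matrix_inv_mult_vector[OF inv])
    have eq: "kform X Y Z x v + psi M v z
       = ((x \<bullet> (X *v x)) / 2 + (z \<bullet> (M *v z)) / 2)
          + v \<bullet> (transpose Y *v x - M *v z) + (v \<bullet> ((Z + M) *v v)) / 2" for v
      using sym_mat_inner_commute[OF M, of v z]
      by (simp add: kform_def psi_def inner_matrix_vector[of x Y] inner_commute[of _ v]
          matrix_vector_mult_add_rdistrib matrix_vector_mult_diff_distrib
          inner_add_right inner_diff_right inner_diff_left field_simps)
    have "F z = ereal (kform X Y Z x y + psi M y z)"
      unfolding F_def plus_ereal.simps eq
      by (rule SUP_ereal_eq_max, rule concave_quadratic_le_stationary[OF neg]) (simp add: Mz)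
    then show "ereal (psi M z y) - F z = ereal (- kform X Y Z x y)"
      by (simp add: psi_commute)
  qed
  ultimately have "(SUP z. ereal (psi M z y) - F z) = ereal (- kform X Y Z x y)"
    by (intro antisym SUP_least SUP_upper2[of z]) auto
  then show ?thesis
    by (simp add: dual_op_def F_def)
qed

definition block_mat ::
  "real ^ 'n ^ 'n \<Rightarrow> real ^ 'n ^ 'n \<Rightarrow> real ^ 'n ^ 'n \<Rightarrow> real ^ 'n ^ 'n \<Rightarrow> real ^ ('n + 'n) ^ ('n + 'n)" where
  "block_mat X Y W Z = (\<chi> i j. case i of
      Inl a \<Rightarrow> (case j of Inl b \<Rightarrow> X $ a $ b | Inr b \<Rightarrow> Y $ a $ b)
    | Inr a \<Rightarrow> (case j of Inl b \<Rightarrow> W $ a $ b | Inr b \<Rightarrow> Z $ a $ b))"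

lemma blocks_block_mat [simp]:
  "block11 (block_mat X Y W Z) = X" "block12 (block_mat X Y W Z) = Y"
  "block21 (block_mat X Y W Z) = W" "block22 (block_mat X Y W Z) = Z"
  by (simp_all add: block11_def block12_def block21_def block22_def block_mat_def vec_eq_iff)

lemma sum_UNIV_Plus:
  fixes f :: "'a::finite + 'b::finite \<Rightarrow> real"
  shows "(\<Sum>i\<in>UNIV. f i) = (\<Sum>a\<in>UNIV. f (Inl a)) + (\<Sum>b\<in>UNIV. f (Inr b))"
  by (simp add: UNIV_Plus_UNIV[symmetric] sum.Plus del: UNIV_Plus_UNIV)

lemma block_mat_form:
  assumes "W = transpose Y"
  shows "1 / 2 * (stack x y \<bullet> (block_mat X Y W Z *v stack x y)) = kform X Y Z x y"
proof -
  have mv: "block_mat X Y W Z *v stack x y = stack (X *v x + Y *v y) (W *v x + Z *v y)"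
    by (simp add: vec_eq_iff stack_def block_mat_def matrix_vector_mult_def sum_UNIV_Plus
        split: sum.split)
  have "stack x y \<bullet> stack u v = x \<bullet> u + y \<bullet> v" for u v
    by (simp add: inner_vec_def stack_def sum_UNIV_Plus)
  moreover have "x \<bullet> (Y *v y) = y \<bullet> (W *v x)"
    by (simp add: assms inner_matrix_vector[of x Y] inner_commute)
  ultimately show ?thesis
    by (simp add: mv kform_def inner_add_right field_simps)
qed

lemma Lam_eq_block_mat:
  fixes X Y Z :: "real ^ 'n ^ 'n"
  assumes X: "sym_mat X" and Z: "sym_mat Z"
    and ker: "\<And>x y. kernel \<Phi> A B \<gamma> M k x y = ereal (kform X Y Z x y)"
  shows "Lam \<Phi> A B \<gamma> M k = block_mat X Y (transpose Y) Z"
  unfolding Lam_def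
proof (rule the_equality)
  let ?L = "block_mat X Y (transpose Y) Z"
  have symL: "sym_mat ?L"
  proof -
    have "X $ b $ a = X $ a $ b" "Z $ b $ a = Z $ a $ b" for a b
      using X Z by (simp_all add: sym_mat_def transpose_def vec_eq_iff)
    then have "?L $ j $ i = ?L $ i $ j" for i j
      by (cases i; cases j) (simp_all add: block_mat_def transpose_def)
    then show ?thesis
      by (simp add: sym_mat_def vec_eq_iff transpose_def)
  qed
  show "sym_mat ?L \<and> (\<forall>x y. kernel \<Phi> A B \<gamma> M k x y
      = ereal (1 / 2 * (stack x y \<bullet> (?L *v stack x y))))"
    by (simp only: symL ker block_mat_form[OF refl] simp_thms)
  fix L assume L: "sym_mat L \<and> (\<forall>x y. kernel \<Phi> A B \<gamma> M k x y
      = ereal (1 / 2 * (stack x y \<bullet> (L *v stack x y))))"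
  show "L = ?L"
  proof (rule sym_mat_eqI)
    fix s :: "real ^ ('n + 'n)"
    have "s = stack (\<chi> a. s $ Inl a) (\<chi> b. s $ Inr b)"
      by (simp add: stack_def vec_eq_iff split: sum.split)
    then obtain x y where s: "s = stack x y" by blast
    have "ereal (1 / 2 * (stack x y \<bullet> (L *v stack x y))) = ereal (kform X Y Z x y)"
      using L ker by metis
    then show "s \<bullet> (L *v s) = s \<bullet> (?L *v s)"
      unfolding s block_mat_form[OF refl, symmetric] by simp
  qed (use L symL in auto)
qed

text \<open>
  Positive definiteness of \<open>M B (\<dots>) B\<^sup>T M\<close> makes \<open>M\<close> and \<open>B\<^sup>T\<close> injective. So \<open>B\<close> is
  surjective, and having at most as many columns as rows it is invertible.
\<close>

lemma standing_assms_invertible: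
  fixes A \<Phi> M :: "real ^ 'n ^ 'n" and B :: "real ^ 'm ^ 'n"
  assumes card: "CARD('m) \<le> CARD('n)" and M: "sym_mat M" and "standing_assms \<Phi> A B \<gamma> M"
  obtains C where "invertible M" "B ** C = mat 1" "C ** B = mat 1"
proof -
  have pd: "pos_def (M ** B ** matrix_inv (riccati_gap B \<gamma> M) ** transpose B ** M)"
    using assms by (simp add: standing_assms_def)
  have inj: "x = 0" if "transpose B *v (M *v x) = 0" for x
  proof (rule ccontr)
    assume "x \<noteq> 0"
    moreover have "(M ** B ** matrix_inv (riccati_gap B \<gamma> M) ** transpose B ** M) *v x = 0"
      using that by (simp del: transpose_matrix_vector flip: matrix_vector_mul_assoc)
    ultimately show False using pd by (metis inner_zero_right less_irrefl pos_def_def)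
  qed
  then have invM: "invertible M"
    by (metis injective_imp_invertible matrix_vector_mult_0_right)
  have inj': "y = 0" if "transpose B *v y = 0" for y
  proof -
    have y: "y = M *v (matrix_inv M *v y)" by (simp add: matrix_inv_mult_vector[OF invM])
    then show ?thesis using that inj by (metis matrix_vector_mult_0_right)
  qed
  then obtain E where E: "E ** transpose B = mat 1"
    by (metis matrix_left_invertible_ker)
  have BC: "B ** transpose E = mat 1"
    by (metis E matrix_transpose_mul transpose_mat transpose_transpose)
  have surj: "surj ((*v) B)"
    by (metis BC matrix_right_invertible_surjective)
  have "inj ((*v) B)"
  proof -
    have "rank B = CARD('n)" using surj by (simp add: full_rank_surjective)
    then have "rank B = CARD('m)" using card rank_bound[of B] by simp
    then show ?thesis by (simp add: full_rank_injective)
  qed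
  then have "transpose E ** B = mat 1"
    using BC by (metis (no_types, lifting) injD matrix_eq matrix_vector_mul_assoc
        matrix_vector_mul_lid)
  with BC invM show thesis using that by blast
qed

section \<open>Representation of Riccati solutions\<close>

theorem theorem5p4:
  fixes A \<Phi> M P0 :: "real ^ 'n ^ 'n"
    and B :: "real ^ 'm ^ 'n"
    and \<gamma> :: real
    and k :: nat
  assumes "CARD('m) \<le> CARD('n)"
    and "sym_mat \<Phi>" and "pos_def \<Phi>"
    and "\<gamma> > 0"
    and "sym_mat M" and "standing_assms \<Phi> A B \<gamma> M"
    and "k \<ge> 1"
    and "sym_mat P0"
    and "neg_def (block22 (Lam \<Phi> A B \<gamma> M k) + P0)"
  shows "dre_solution \<Phi> A B \<gamma> P0 k ((riccati \<Phi> A B \<gamma> ^^ k) P0) \<and>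
    (riccati \<Phi> A B \<gamma> ^^ k) P0 = Psi_p \<Phi> A B \<gamma> M k P0"
proof -
  obtain C where invM: "invertible M" and BC: "B ** C = mat 1" and CB: "C ** B = mat 1"
    using standing_assms_invertible assms(1,5,6) by blast
  interpret invertible_input \<Phi> A B C \<gamma>
    by unfold_locales (fact assms(2) BC CB)+
  have gapM: "\<And>i. pos_def (riccati_gap B \<gamma> ((\<R> ^^ i) M))"
    using assms(6) by (simp add: standing_assms_def)
  obtain j where k: "k = Suc j" using assms(7) by (cases k) auto
  obtain X Y Z where X: "sym_mat X" and Z: "sym_mat Z"
    and dp: "\<And>\<phi> x. (dp_op \<Phi> A B \<gamma> ^^ k) \<phi> x = (SUP y. ereal (kform X Y Z x y) + \<phi> y)"
    and gaps: "\<And>P. sym_mat P \<Longrightarrow>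
      neg_def (Z + P) \<longleftrightarrow> (\<forall>i<k. pos_def (riccati_gap B \<gamma> ((\<R> ^^ i) P)))"
    using dp_op_funpow_eq_kernel[OF assms(5) gapM, of j] unfolding k by blast
  have "kernel \<Phi> A B \<gamma> M k x y = ereal (kform X Y Z x y)" for x y
    unfolding kernel_def aux_value_def dp
    using gaps gapM assms(5) invM by (intro dual_op_SUP_kform) auto
  then have L: "Lam \<Phi> A B \<gamma> M k = block_mat X Y (transpose Y) Z"
    by (rule Lam_eq_block_mat[OF X Z])
  have neg: "neg_def (Z + P0)" using assms(9) by (simp add: L)
  then have gapP: "\<forall>i<k. pos_def (riccati_gap B \<gamma> ((\<R> ^^ i) P0))"
    using gaps[OF assms(8)] by simp
  note quad = dp_op_funpow_quadratic[OF assms(2,8) gapP]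
  have "(\<R> ^^ k) P0 = schur_compl X Y (Z + P0)"
  proof (rule sym_mat_eqI)
    show "sym_mat ((\<R> ^^ k) P0)" using quad by simp
    show "sym_mat (schur_compl X Y (Z + P0))" by (rule sym_mat_schur_compl[OF X neg])
    fix x
    have "ereal ((x \<bullet> ((\<R> ^^ k) P0 *v x)) / 2)
        = (dp_op \<Phi> A B \<gamma> ^^ k) (\<lambda>y. ereal ((y \<bullet> (P0 *v y)) / 2)) x"
      using quad by simp
    also have "\<dots> = ereal ((x \<bullet> (schur_compl X Y (Z + P0) *v x)) / 2)"
      unfolding dp by (rule SUP_kform_add_quadratic[OF neg])
    finally show "x \<bullet> ((\<R> ^^ k) P0 *v x) = x \<bullet> (schur_compl X Y (Z + P0) *v x)" by simp
  qed
  then show ?thesis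
    using gapP by (simp add: dre_solution_def Psi_p_def L Let_def schur_compl_def add.commute)
qed

end
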